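(* Let $I$ be a non-empty set, $E$ a linear subspace of $\mathbb{R}^I$ with an absolute norm such that $\operatorname{span}\{e_i : i\in I\}$ is dense in $E$, and $(X_i)_{i\in I}$ a family of Banach spaces which are weakly octahedral. Then their absolute sum $X=[\oplus_{i\in I}X_i]_E$ is weakly octahedral.
   Context: All Banach spaces are real. $S_X$ and $B_X$ denote the unit sphere and closed unit ball of $X$. A Banach space $X$ is weakly octahedral if for every finite subset $(x_i)_{i=1}^N\subset S_X$, every $x^*\in B_{X^*}$, and every $\varepsilon>0$ there exists $y\in S_X$ such that $\|x_i+ty\|\ge(1-\varepsilon)(|x^*(x_i)|+t)$ for all $i=1,\ldots,N$ and all $t>0$. Let $I$ be a non-empty set and $E$ a linear subspace of $\mathbb{R}^I$. An absolute norm on $E$ is a complete norm $\|\cdot\|_E$ on $E$ such that: (i) given $(a_i)_{i\in I},(b_i)_{i\in I}\in\mathbb{R}^I$ with $|b_i|\le|a_i|$ for every $i\in I$, if $(a_i)_{i\in I}\in E$ then $(b_i)_{i\in I}\in E$ and $\|(b_i)_{i\in I}\|_E\le\|(a_i)_{i\in I}\|_E$; (ii) for every $i\in I$ the function $e_i:I\to\mathbb{R}$, $e_i(j)=\delta_{ij}$, belongs to $E$ and $\|e_i\|_E=1$. The absolute sum of a family $(X_i)_{i\in I}$ of Banach spaces with respect to $E$ is $[\oplus_{i\in I}X_i]_E=\{(x_i)_{i\in I}\in\prod_{i\in I}X_i : (\|x_i\|)_{i\in I}\in E\}$, a Banach space with norm $\|(x_i)_{i\in I}\|=\|(\|x_i\|)_{i\in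 I}\|_E$. *)

theory Defs
  imports "HOL-Analysis.Analysis" "HOL-Library.Function_Algebras"
begin

instantiation "fun" :: (type, real_vector) real_vector
begin

definition scaleR_fun_def: "c *\<^sub>R f = (\<lambda>i. c *\<^sub>R f i)"

instance
  by standard (simp_all add: scaleR_fun_def fun_eq_iff scaleR_add_right scaleR_add_left)

end

text \<open>
  A normed space is a linear subspace V of a real vector space together with its own norm N
  (values of N outside V are irrelevant). No norm on the ambient space is involved, so an
  arbitrary family of Banach spaces can be described with a single ambient space, for instance
  the algebraic direct sum of the underlying vector spaces.
\<close>

locale normed_space =
  fixes V :: "'a::real_vector set" and N :: "'a \<Rightarrow> real"
  assumes subspace_carrier: "subspace V"
    and norm_nonneg: "x \<in> V \<Longrightarrow> 0 \<le> N x"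
    and norm_eq_zero_iff: "x \<in> V \<Longrightarrow> N x = 0 \<longleftrightarrow> x = 0"
    and norm_scale: "x \<in> V \<Longrightarrow> N (c *\<^sub>R x) = \<bar>c\<bar> * N x"
    and norm_triangle: "x \<in> V \<Longrightarrow> y \<in> V \<Longrightarrow> N (x + y) \<le> N x + N y"

text \<open>The locale \<^locale>\<open>Metric_space\<close> wants symmetry and nonnegativity on the whole type,
  hence the value 0 outside the carrier.\<close>

definition norm_dist :: "'a::real_vector set \<Rightarrow> ('a \<Rightarrow> real) \<Rightarrow> 'a \<Rightarrow> 'a \<Rightarrow> real" where
  "norm_dist V N x y = (if x \<in> V \<and> y \<in> V then N (x - y) else 0)"

sublocale normed_space \<subseteq> Metric_space V "norm_dist V N"
proof
  have minus: "x - y \<in> V" if "x \<in> V" "y \<in> V" for x y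
    using subspace_diff[OF subspace_carrier that] .
  show "0 \<le> norm_dist V N x y" for x y
    by (simp add: norm_dist_def norm_nonneg minus)
  show "norm_dist V N x y = norm_dist V N y x" for x y
    using norm_scale[OF minus, of x y "-1"] by (auto simp: norm_dist_def)
  show "(norm_dist V N x y = 0) = (x = y)" if "x \<in> V" "y \<in> V" for x y
    using that by (simp add: norm_dist_def norm_eq_zero_iff minus)
  show "norm_dist V N x z \<le> norm_dist V N x y + norm_dist V N y z"
    if "x \<in> V" "y \<in> V" "z \<in> V" for x y z
    using that norm_triangle[OF minus minus, of x y y z] by (simp add: norm_dist_def)
qed

locale banach_space = normed_space +
  assumes complete: "mcomplete"

definition unit_sphere :: "'a::real_vector set \<Rightarrow> ('a \<Rightarrow> real) \<Rightarrow> 'a set" where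
  "unit_sphere V N = {x \<in> V. N x = 1}"

definition unit_ball :: "'a::real_vector set \<Rightarrow> ('a \<Rightarrow> real) \<Rightarrow> 'a set" where
  "unit_ball V N = {x \<in> V. N x \<le> 1}"

text \<open>Functionals on V are represented by functions on the ambient space; only their values on V
  matter.\<close>

definition bounded_functional ::
    "'a::real_vector set \<Rightarrow> ('a \<Rightarrow> real) \<Rightarrow> ('a \<Rightarrow> real) \<Rightarrow> bool" where
  "bounded_functional V N f \<longleftrightarrow>
     (\<forall>x\<in>V. \<forall>y\<in>V. f (x + y) = f x + f y) \<and>
     (\<forall>c. \<forall>x\<in>V. f (c *\<^sub>R x) = c * f x) \<and>
     (\<exists>K. \<forall>x\<in>V. \<bar>f x\<bar> \<le> K * N x)"

definition dual_norm :: "'a::real_vector set \<Rightarrow> ('a \<Rightarrow> real) \<Rightarrow> ('a \<Rightarrow> real) \<Rightarrow> real" where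
  "dual_norm V N f = (SUP x\<in>unit_ball V N. \<bar>f x\<bar>)"

definition dual_unit_ball :: "'a::real_vector set \<Rightarrow> ('a \<Rightarrow> real) \<Rightarrow> ('a \<Rightarrow> real) set" where
  "dual_unit_ball V N = {f. bounded_functional V N f \<and> dual_norm V N f \<le> 1}"

text \<open>A finite family is indexed by 1, ..., n with n at least 1, so F is non-empty. This
  only matters for the zero space, whose unit sphere is empty.\<close>

definition weakly_octahedral :: "'a::real_vector set \<Rightarrow> ('a \<Rightarrow> real) \<Rightarrow> bool" where
  "weakly_octahedral V N \<longleftrightarrow>
     banach_space V N \<and>
     (\<forall>F f \<epsilon>. finite F \<and> F \<noteq> {} \<and> F \<subseteq> unit_sphere V N \<and> f \<in> dual_unit_ball V N \<and> 0 < \<epsilon> \<longrightarrow>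
        (\<exists>y\<in>unit_sphere V N. \<forall>x\<in>F. \<forall>t>0. (1 - \<epsilon>) * (\<bar>f x\<bar> + t) \<le> N (x + t *\<^sub>R y)))"

definition unit_fun :: "'i \<Rightarrow> 'i \<Rightarrow> real" where
  "unit_fun i = (\<lambda>j. if i = j then 1 else 0)"

text \<open>The non-empty index set is the type \<open>'i\<close>.\<close>

locale absolute_norm = banach_space E NE
  for E :: "('i \<Rightarrow> real) set" and NE :: "('i \<Rightarrow> real) \<Rightarrow> real" +
  assumes solid: "(\<And>i. \<bar>b i\<bar> \<le> \<bar>a i\<bar>) \<Longrightarrow> a \<in> E \<Longrightarrow> b \<in> E \<and> NE b \<le> NE a"
    and unit_fun_in: "unit_fun i \<in> E"
    and norm_unit_fun: "NE (unit_fun i) = 1"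

definition abs_sum ::
    "('i \<Rightarrow> real) set \<Rightarrow> ('i \<Rightarrow> 'a set) \<Rightarrow> ('i \<Rightarrow> 'a \<Rightarrow> real) \<Rightarrow> ('i \<Rightarrow> 'a) set" where
  "abs_sum E X NX = {x. (\<forall>i. x i \<in> X i) \<and> (\<lambda>i. NX i (x i)) \<in> E}"

definition abs_sum_norm ::
    "(('i \<Rightarrow> real) \<Rightarrow> real) \<Rightarrow> ('i \<Rightarrow> 'a \<Rightarrow> real) \<Rightarrow> ('i \<Rightarrow> 'a) \<Rightarrow> real" where
  "abs_sum_norm NE NX x = NE (\<lambda>i. NX i (x i))"

end

theory Submission
  imports Defs
begin

text \<open>Completeness of the absolute sum is coordinatewise. For weak octahedrality, let \<open>x\<^sup>*\<close> be
  a functional with restrictions \<open>x\<^sub>i\<^sup>*\<close> to the summands. The weights \<open>\<phi>\<^sub>i = \<parallel>x\<^sub>i\<^sup>*\<parallel> / \<parallel>x\<^sup>*\<parallel>\<close>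
  form a functional of norm at most 1 on E, and by density it is almost normed by
  \<open>a = (\<parallel>z\<^sub>i\<parallel>)\<^sub>i\<close> for a finitely supported unit vector z. Put \<open>y = (a\<^sub>i y\<^sub>i)\<^sub>i\<close>, where \<open>y\<^sub>i\<close>
  witnesses weak octahedrality of the i-th summand for the i-th coordinates of the given vectors
  and \<open>x\<^sub>i\<^sup>*\<close>; testing the norm of \<open>x + t y\<close> against \<open>\<phi>\<close> gives the required bound. For
  \<open>x\<^sup>* = 0\<close> the weights of a single coordinate functional do the same.\<close>

section \<open>Normed spaces and dual norms\<close>

context normed_space
begin

lemma norm_zero: "N 0 = 0"
  using norm_eq_zero_iff subspace_0[OF subspace_carrier] by blast

lemma diff_in: "x \<in> V \<Longrightarrow> y \<in> V \<Longrightarrow> x - y \<in> V"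
  by (rule subspace_diff[OF subspace_carrier])

lemma add_in: "x \<in> V \<Longrightarrow> y \<in> V \<Longrightarrow> x + y \<in> V"
  by (rule subspace_add[OF subspace_carrier])

lemma scale_in: "x \<in> V \<Longrightarrow> c *\<^sub>R x \<in> V"
  by (rule subspace_scale[OF subspace_carrier])

lemma zero_in: "0 \<in> V"
  by (rule subspace_0[OF subspace_carrier])

lemma norm_diff_commute:
  assumes "x \<in> V" "y \<in> V"
  shows "N (x - y) = N (y - x)"
  using norm_scale[OF diff_in[OF assms], of "-1"] by simp

lemma norm_diff_triangle:
  assumes "x \<in> V" "y \<in> V"
  shows "\<bar>N x - N y\<bar> \<le> N (x - y)"
  using norm_triangle[OF diff_in[OF assms] assms(2)]
    norm_triangle[OF diff_in[OF assms(2,1)] assms(1)] norm_diff_commute[OF assms]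
  by simp

lemma MCauchy_iff_norm:
  "MCauchy \<sigma> \<longleftrightarrow> (\<forall>n. \<sigma> n \<in> V) \<and> (\<forall>e>0. \<exists>M. \<forall>m\<ge>M. \<forall>n\<ge>M. N (\<sigma> m - \<sigma> n) < e)"
  unfolding MCauchy_def norm_dist_def by (auto simp: image_subset_iff)

lemma limitin_iff_norm:
  assumes "\<And>n. \<sigma> n \<in> V"
  shows "limitin mtopology \<sigma> x sequentially \<longleftrightarrow> x \<in> V \<and> (\<lambda>n. N (\<sigma> n - x)) \<longlonglongrightarrow> 0"
  unfolding limit_metric_sequentially norm_dist_def LIMSEQ_iff
  using assms by (auto simp: norm_nonneg diff_in)

lemma bounded_functional_diff:
  assumes "bounded_functional V N f" "x \<in> V" "y \<in> V"
  shows "f (x - y) = f x - f y"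
proof -
  have "f (x + (-1) *\<^sub>R y) = f x + f ((-1) *\<^sub>R y)" "f ((-1) *\<^sub>R y) = - 1 * f y"
    using assms scale_in[OF assms(3)] unfolding bounded_functional_def by blast+
  then show ?thesis by simp
qed

lemma bdd_above_dual_norm:
  assumes "bounded_functional V N f"
  shows "bdd_above ((\<lambda>x. \<bar>f x\<bar>) ` unit_ball V N)"
proof -
  obtain K where K: "\<And>x. x \<in> V \<Longrightarrow> \<bar>f x\<bar> \<le> K * N x"
    using assms unfolding bounded_functional_def by blast
  have "\<bar>f x\<bar> \<le> \<bar>K\<bar>" if "x \<in> unit_ball V N" for x
  proof -
    have x: "x \<in> V" "N x \<le> 1"
      using that by (auto simp: unit_ball_def)
    have "K * N x \<le> \<bar>K\<bar> * N x"
      using norm_nonneg[OF x(1)] by (intro mult_right_mono) auto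
    also have "\<dots> \<le> \<bar>K\<bar> * 1"
      using x(2) by (intro mult_left_mono) auto
    finally show ?thesis
      using K[OF x(1)] by simp
  qed
  then show ?thesis
    by (intro bdd_aboveI2)
qed

lemma dual_norm_bound:
  assumes f: "bounded_functional V N f" and x: "x \<in> V"
  shows "\<bar>f x\<bar> \<le> dual_norm V N f * N x"
proof (cases "x = 0")
  case True
  have "f (0 *\<^sub>R 0) = 0 * f 0"
    using f zero_in unfolding bounded_functional_def by blast
  with True show ?thesis
    by (simp add: norm_zero)
next
  case False
  then have pos: "0 < N x"
    using x norm_nonneg[of x] norm_eq_zero_iff[of x] by linarith
  then have "(1 / N x) *\<^sub>R x \<in> unit_ball V N"
    using x by (simp add: unit_ball_def scale_in norm_scale)
  then have "\<bar>f ((1 / N x) *\<^sub>R x)\<bar> \<le> dual_norm V N f"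
    unfolding dual_norm_def by (rule cSUP_upper) (rule bdd_above_dual_norm[OF f])
  moreover have "f ((1 / N x) *\<^sub>R x) = 1 / N x * f x"
    using f x unfolding bounded_functional_def by blast
  ultimately show ?thesis
    using pos by (simp add: abs_mult field_simps)
qed

lemma dual_norm_nonneg:
  assumes "bounded_functional V N f"
  shows "0 \<le> dual_norm V N f"
proof -
  have "\<bar>f 0\<bar> \<le> dual_norm V N f"
    unfolding dual_norm_def using zero_in norm_zero
    by (intro cSUP_upper bdd_above_dual_norm[OF assms]) (simp add: unit_ball_def)
  then show ?thesis by simp
qed

text \<open>The supremum runs over absolute values, so a near-maximiser at which \<open>f\<close> is
  negative is replaced by its opposite, which has the same norm.\<close>

lemma dual_norm_approx:
  assumes f: "bounded_functional V N f" and b: "b < dual_norm V N f"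
  obtains z where "z \<in> V" "N z \<le> 1" "b < f z"
proof -
  have "unit_ball V N \<noteq> {}"
    using zero_in norm_zero by (auto simp: unit_ball_def intro!: exI[of _ 0])
  then obtain z where "z \<in> unit_ball V N" "b < \<bar>f z\<bar>"
    using b less_cSUP_iff[OF _ bdd_above_dual_norm[OF f]] unfolding dual_norm_def by blast
  then have z: "z \<in> V" "N z \<le> 1" "b < \<bar>f z\<bar>"
    by (auto simp: unit_ball_def)
  moreover have "f ((-1) *\<^sub>R z) = -1 * f z"
    using f z unfolding bounded_functional_def by blast
  moreover have "N ((-1) *\<^sub>R z) = N z"
    using norm_scale[OF z(1), of "-1"] by simp
  ultimately show thesis
    using that[of z] that[of "(-1) *\<^sub>R z"] scale_in[OF z(1), of "-1"]
    by (cases "0 \<le> f z") auto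
qed

end

section \<open>Completeness in terms of the norm\<close>

text \<open>On \<open>V\<close> the distance \<open>norm_dist\<close> is the norm of the difference.
  This form allows completeness to be proved and applied without metric topologies.\<close>

lemma banach_space_iff:
  "banach_space V N \<longleftrightarrow> normed_space V N \<and>
     (\<forall>\<sigma>. (\<forall>n. \<sigma> n \<in> V) \<longrightarrow> (\<forall>e>0. \<exists>M. \<forall>m\<ge>M. \<forall>n\<ge>M. N (\<sigma> m - \<sigma> n) < e) \<longrightarrow>
        (\<exists>x\<in>V. (\<lambda>n. N (\<sigma> n - x)) \<longlonglongrightarrow> 0))"
proof (cases "normed_space V N")
  case True
  then interpret normed_space V N .
  have "(\<exists>x. limitin mtopology \<sigma> x sequentially) \<longleftrightarrow> (\<exists>x\<in>V. (\<lambda>n. N (\<sigma> n - x)) \<longlonglongrightarrow> 0)"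
    if "\<forall>n. \<sigma> n \<in> V" for \<sigma>
    using limitin_iff_norm[of \<sigma>] that by auto
  then show ?thesis
    unfolding banach_space_def banach_space_axioms_def mcomplete_def MCauchy_iff_norm
    by (simp add: True imp_conjL cong: imp_cong)
qed (simp add: banach_space_def)

lemma banach_space_convergent:
  assumes "banach_space V N" "\<And>n. \<sigma> n \<in> V"
    and "\<And>e. 0 < e \<Longrightarrow> \<exists>M. \<forall>m\<ge>M. \<forall>n\<ge>M. N (\<sigma> m - \<sigma> n) < e"
  obtains x where "x \<in> V" "(\<lambda>n. N (\<sigma> n - x)) \<longlonglongrightarrow> 0"
proof -
  have "\<forall>n. \<sigma> n \<in> V" "\<forall>e>0. \<exists>M. \<forall>m\<ge>M. \<forall>n\<ge>M. N (\<sigma> m - \<sigma> n) < e"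
    using assms(2,3) by auto
  with assms(1) have "\<exists>x\<in>V. (\<lambda>n. N (\<sigma> n - x)) \<longlonglongrightarrow> 0"
    unfolding banach_space_iff by auto
  with that show thesis by blast
qed

section \<open>Homogeneous form of weak octahedrality\<close>

text \<open>Multiplying by c keeps the case c = 0 and removes the normalisation of the vectors.\<close>

lemma weakly_octahedral_scaled:
  assumes wo: "weakly_octahedral V N"
    and F: "finite F" "F \<subseteq> V"
    and z: "z \<in> V" "z \<noteq> 0"
    and c: "0 \<le> c"
    and f_add: "\<And>x y. x \<in> V \<Longrightarrow> y \<in> V \<Longrightarrow> f (x + y) = f x + f y"
    and f_scale: "\<And>k x. x \<in> V \<Longrightarrow> f (k *\<^sub>R x) = k * f x"
    and f_bound: "\<And>x. x \<in> V \<Longrightarrow> \<bar>f x\<bar> \<le> c * N x"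
    and \<epsilon>: "0 < \<epsilon>" "\<epsilon> < 1"
  obtains y where "y \<in> V" "N y = 1"
    "\<And>x t. x \<in> F \<Longrightarrow> 0 \<le> t \<Longrightarrow> (1 - \<epsilon>) * (\<bar>f x\<bar> + c * t) \<le> c * N (x + t *\<^sub>R y)"
proof -
  interpret banach_space V N
    using wo by (simp add: weakly_octahedral_def)
  define u where "u x = (1 / N x) *\<^sub>R x" for x
  have pos: "0 < N x" if "x \<in> V" "x \<noteq> 0" for x
    using that norm_nonneg[of x] norm_eq_zero_iff[of x] by linarith
  have u: "u x \<in> V" "N (u x) = 1" if "x \<in> V" "x \<noteq> 0" for x
    using that pos[OF that] by (auto simp: u_def norm_scale scale_in)
  show thesis
  proof (cases "c = 0")
    case True
    \<comment> \<open>Here \<open>f_bound\<close> forces \<open>f\<close> to vanish on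
      \<open>V\<close>, so both sides are zero and any unit vector will do. The vector
      \<open>z\<close> provides one.\<close>
    then show thesis
      using that[of "u z"] u[OF z] f_bound F(2) by fastforce
  next
    case False
    with c have c: "0 < c" by simp
    define g where "g x = f x / c" for x
    have g_bound: "\<bar>g x\<bar> \<le> N x" if "x \<in> V" for x
      using f_bound[OF that] c by (simp add: g_def divide_simps mult.commute)
    \<comment> \<open>The zero vector cannot be normalised and is dropped. Adding \<open>z\<close>
      keeps \<open>G\<close> non-empty even if \<open>F\<close> contains no other vector than
      0.\<close>
    define G where "G = u ` (insert z F - {0})"
    have "finite G" "G \<noteq> {}" "G \<subseteq> unit_sphere V N"
      using F z u by (auto simp: G_def unit_sphere_def)
    moreover have "g \<in> dual_unit_ball V N"
    proof -
      have "dual_norm V N g \<le> 1"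
        unfolding dual_norm_def
      proof (rule cSUP_least)
        show "unit_ball V N \<noteq> {}"
          using zero_in norm_zero by (auto simp: unit_ball_def intro!: exI[of _ 0])
        show "\<bar>g x\<bar> \<le> 1" if "x \<in> unit_ball V N" for x
          using that g_bound[of x] by (auto simp: unit_ball_def)
      qed
      moreover have "\<exists>K. \<forall>x\<in>V. \<bar>g x\<bar> \<le> K * N x"
        using g_bound by (intro exI[of _ 1]) simp
      ultimately show ?thesis
        by (simp add: dual_unit_ball_def bounded_functional_def g_def f_add f_scale
            add_divide_distrib)
    qed
    ultimately obtain y where y: "y \<in> unit_sphere V N"
      and y_ineq: "\<And>x t. x \<in> G \<Longrightarrow> 0 < t \<Longrightarrow> (1 - \<epsilon>) * (\<bar>g x\<bar> + t) \<le> N (x + t *\<^sub>R y)"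
      using wo \<epsilon>(1) unfolding weakly_octahedral_def by meson
    have y': "y \<in> V" "N y = 1"
      using y by (auto simp: unit_sphere_def)
    have main: "(1 - \<epsilon>) * (\<bar>g x\<bar> + t) \<le> N (x + t *\<^sub>R y)" if xF: "x \<in> F" and t: "0 \<le> t" for x t
    proof -
      have xV: "x \<in> V"
        using xF F by auto
      \<comment> \<open>Weak octahedrality speaks only of t > 0 and of unit vectors. The case t = 0
        follows from \<open>g_bound\<close>, the case x = 0 from \<open>N y = 1\<close>.\<close>
      consider "t = 0" | "x = 0" | "0 < t" "x \<noteq> 0"
        using t by fastforce
      then show ?thesis
      proof cases
        case 1
        have "(1 - \<epsilon>) * \<bar>g x\<bar> \<le> 1 * \<bar>g x\<bar>"
          using \<epsilon> by (intro mult_right_mono) auto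
        then show ?thesis
          using g_bound[OF xV] 1 by simp
      next
        case 2
        have "g x = 0"
          using g_bound[OF xV] 2 norm_zero by simp
        moreover have "(1 - \<epsilon>) * t \<le> 1 * t"
          using \<epsilon> t by (intro mult_right_mono) auto
        ultimately show ?thesis
          using 2 y' t by (simp add: norm_scale)
      next
        case 3
        define r where "r = N x"
        have r: "0 < r"
          using pos[OF xV 3(2)] by (simp add: r_def)
        \<comment> \<open>The inequality for the normalised vector is used at parameter
          \<open>t / r\<close>, so that multiplication by \<open>r\<close> returns \<open>x\<close>
          and \<open>t\<close>.\<close>
        have "(1 - \<epsilon>) * (\<bar>g (u x)\<bar> + t / r) \<le> N (u x + (t / r) *\<^sub>R y)"
          using xF 3 r by (intro y_ineq) (auto simp: G_def)
        then have "r * ((1 - \<epsilon>) * (\<bar>g (u x)\<bar> + t / r)) \<le> r * N (u x + (t / r) *\<^sub>R y)"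
          using r by simp
        also have "r * N (u x + (t / r) *\<^sub>R y) = N (r *\<^sub>R (u x + (t / r) *\<^sub>R y))"
          using r u(1)[OF xV 3(2)] y' by (subst norm_scale) (auto intro: add_in scale_in)
        also have "r *\<^sub>R (u x + (t / r) *\<^sub>R y) = x + t *\<^sub>R y"
          using r by (simp add: u_def r_def scaleR_add_right)
        also have "r * ((1 - \<epsilon>) * (\<bar>g (u x)\<bar> + t / r)) = (1 - \<epsilon>) * (\<bar>g x\<bar> + t)"
          using r by (simp add: g_def u_def f_scale[OF xV] r_def[symmetric] abs_mult field_simps)
        finally show ?thesis .
      qed
    qed
    show thesis
    proof (rule that[OF y'])
      fix x t assume "x \<in> F" "(0::real) \<le> t"
      then have "c * ((1 - \<epsilon>) * (\<bar>g x\<bar> + t)) \<le> c * N (x + t *\<^sub>R y)"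
        using c main by simp
      also have "c * ((1 - \<epsilon>) * (\<bar>g x\<bar> + t)) = (1 - \<epsilon>) * (c * \<bar>g x\<bar> + c * t)"
        by (simp add: algebra_simps)
      also have "c * \<bar>g x\<bar> = \<bar>f x\<bar>"
        using c by (simp add: g_def)
      finally show "(1 - \<epsilon>) * (\<bar>f x\<bar> + c * t) \<le> c * N (x + t *\<^sub>R y)" .
    qed
  qed
qed

section \<open>Coordinates and finite supports in E\<close>

context absolute_norm
begin

text \<open>Solidity compares \<open>a\<close> with its part at \<open>i\<close>. Hence coordinates
  are continuous, and a norm limit in E is also a pointwise limit.\<close>

lemma coordinate_le: "a \<in> E \<Longrightarrow> \<bar>a i\<bar> \<le> NE a"
proof -
  assume a: "a \<in> E"
  have "NE (a i *\<^sub>R unit_fun i) \<le> NE a"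
    by (rule solid[THEN conjunct2, OF _ a]) (simp add: scaleR_fun_def unit_fun_def)
  then show ?thesis
    by (simp add: norm_scale unit_fun_in norm_unit_fun)
qed

text \<open>Completeness provides some limit in norm, and continuity of the coordinates identifies
  it with the pointwise limit \<open>a\<close>.\<close>

lemma pointwise_limit:
  assumes \<sigma>: "\<And>n. \<sigma> n \<in> E"
    and cauchy: "\<And>e. 0 < e \<Longrightarrow> \<exists>M. \<forall>m\<ge>M. \<forall>n\<ge>M. NE (\<sigma> m - \<sigma> n) < e"
    and lim: "\<And>i. (\<lambda>n. \<sigma> n i) \<longlonglongrightarrow> a i"
  shows "a \<in> E" "(\<lambda>n. NE (\<sigma> n - a)) \<longlonglongrightarrow> 0"
proof -
  have "banach_space E NE" by unfold_locales
  then obtain b where b: "b \<in> E" "(\<lambda>n. NE (\<sigma> n - b)) \<longlonglongrightarrow> 0"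
    using banach_space_convergent[of E NE \<sigma>, OF _ \<sigma> cauchy] by blast
  have "b i = a i" for i
  proof -
    have "(\<lambda>n. \<sigma> n i - b i) \<longlonglongrightarrow> 0"
      using coordinate_le[OF diff_in[OF \<sigma> b(1)]]
      by (intro Lim_null_comparison[OF _ b(2)] always_eventually) (auto simp: fun_diff_def)
    then have "(\<lambda>n. \<sigma> n i) \<longlonglongrightarrow> b i"
      by (simp add: LIM_zero_iff)
    then show ?thesis
      using lim[of i] LIMSEQ_unique by blast
  qed
  then have "b = a" by auto
  with b show "a \<in> E" "(\<lambda>n. NE (\<sigma> n - a)) \<longlonglongrightarrow> 0" by auto
qed

lemma finite_support_in:
  assumes "finite {i. a i \<noteq> 0}"
  shows "a \<in> E"
proof -
  have "a = (\<Sum>i | a i \<noteq> 0. a i *\<^sub>R unit_fun i)"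
  proof
    fix j
    have "(\<Sum>i | a i \<noteq> 0. a i *\<^sub>R unit_fun i) j = (\<Sum>i | a i \<noteq> 0. a i *\<^sub>R unit_fun i j)"
      using assms by (induction rule: finite_induct) (auto simp: scaleR_fun_def)
    also have "\<dots> = (\<Sum>i | a i \<noteq> 0. if i = j then a i else 0)"
      by (intro sum.cong) (auto simp: unit_fun_def)
    also have "\<dots> = a j"
      using assms by simp
    finally show "a j = (\<Sum>i | a i \<noteq> 0. a i *\<^sub>R unit_fun i) j" ..
  qed
  also have "\<dots> \<in> E"
    by (intro subspace_sum[OF subspace_carrier] scale_in unit_fun_in)
  finally show ?thesis .
qed

end

text \<open>The form in which density is applied: an approximant from the span singles out a finite
  set of coordinates.\<close>

lemma span_unit_fun_finite_support:
  assumes "s \<in> span (range unit_fun)"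
  shows "finite {i. s i \<noteq> (0::real)}"
  using assms
proof (induction rule: span_induct_alt)
  case base
  then show ?case by simp
next
  case (step c x y)
  then obtain i where "x = unit_fun i" by auto
  then have "{j. (c *\<^sub>R x + y) j \<noteq> 0} \<subseteq> insert i {j. y j \<noteq> 0}"
    by (auto simp: scaleR_fun_def unit_fun_def)
  with step show ?case
    by (meson finite.insertI finite_subset)
qed

section \<open>The absolute sum as a normed space\<close>

text \<open>\<open>restr K\<close> is the coordinate projection onto the summands in
  \<open>K\<close>. Applied to a constant function with \<open>K = {i}\<close>, it doubles as the
  embedding of the i-th summand into the sum.\<close>

definition restr :: "'i set \<Rightarrow> ('i \<Rightarrow> 'a::zero) \<Rightarrow> 'i \<Rightarrow> 'a" where
  "restr K w = (\<lambda>i. if i \<in> K then w i else 0)"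

locale absolute_sum = absolute_norm E NE
  for E :: "('i \<Rightarrow> real) set" and NE +
  fixes X :: "'i \<Rightarrow> 'a::real_vector set" and NX :: "'i \<Rightarrow> 'a \<Rightarrow> real"
  assumes summand: "\<And>i. normed_space (X i) (NX i)"
begin

lemmas X_zero = normed_space.zero_in[OF summand]
  and X_add = normed_space.add_in[OF summand]
  and X_scale = normed_space.scale_in[OF summand]
  and X_diff = normed_space.diff_in[OF summand]
  and NX_zero = normed_space.norm_zero[OF summand]
  and NX_nonneg = normed_space.norm_nonneg[OF summand]
  and NX_eq_zero = normed_space.norm_eq_zero_iff[OF summand]
  and NX_scale = normed_space.norm_scale[OF summand]
  and NX_triangle = normed_space.norm_triangle[OF summand]

abbreviation W where "W \<equiv> abs_sum E X NX"
abbreviation NW where "NW \<equiv> abs_sum_norm NE NX"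

lemma W_coord: "x \<in> W \<Longrightarrow> x i \<in> X i"
  and W_norms: "x \<in> W \<Longrightarrow> (\<lambda>i. NX i (x i)) \<in> E"
  by (auto simp: abs_sum_def)

text \<open>Solidity of E carried over to vectors, the source of most norm estimates in the sum. The
  absolute value admits signed \<open>a\<close>, such as a difference of two families.\<close>

lemma W_solid:
  assumes x: "\<And>i. x i \<in> X i" and a: "a \<in> E" and le: "\<And>i. NX i (x i) \<le> \<bar>a i\<bar>"
  shows "x \<in> W" "NW x \<le> NE a"
proof -
  have "(\<lambda>i. NX i (x i)) \<in> E \<and> NE (\<lambda>i. NX i (x i)) \<le> NE a"
    by (rule solid[OF _ a]) (simp add: le NX_nonneg x)
  then show "x \<in> W" "NW x \<le> NE a"
    by (auto simp: abs_sum_def abs_sum_norm_def x)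
qed

lemma normed_space_W: "normed_space W NW"
proof
  have add: "x + y \<in> W \<and> NW (x + y) \<le> NW x + NW y" if "x \<in> W" "y \<in> W" for x y
  proof -
    have E: "(\<lambda>i. NX i (x i)) + (\<lambda>i. NX i (y i)) \<in> E"
      using that by (intro add_in W_norms)
    have "(x + y) i \<in> X i \<and> NX i ((x + y) i) \<le> \<bar>((\<lambda>i. NX i (x i)) + (\<lambda>i. NX i (y i))) i\<bar>" for i
      using NX_triangle[of "x i" i "y i"] that by (auto simp: X_add W_coord)
    then have "x + y \<in> W" "NW (x + y) \<le> NE ((\<lambda>i. NX i (x i)) + (\<lambda>i. NX i (y i)))"
      using W_solid[OF _ E, of "x + y"] by blast+
    then show ?thesis
      using norm_triangle[OF W_norms[OF that(1)] W_norms[OF that(2)]]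
      by (simp add: abs_sum_norm_def)
  qed
  have scale: "(\<lambda>i. NX i ((c *\<^sub>R x) i)) = \<bar>c\<bar> *\<^sub>R (\<lambda>i. NX i (x i))" if "x \<in> W" for c x
    using that by (auto simp: scaleR_fun_def NX_scale W_coord)
  show "subspace W"
  proof (rule subspaceI)
    show "0 \<in> W"
      using zero_in by (auto simp: abs_sum_def X_zero NX_zero zero_fun_def)
    show "c *\<^sub>R x \<in> W" if "x \<in> W" for c x
      using that scale[OF that, of c] scale_in[OF W_norms[OF that]]
      by (auto simp: abs_sum_def X_scale scaleR_fun_def)
  qed (use add in blast)
  show "0 \<le> NW x" if "x \<in> W" for x
    using norm_nonneg[OF W_norms[OF that]] by (simp add: abs_sum_norm_def)
  show "NW x = 0 \<longleftrightarrow> x = 0" if "x \<in> W" for x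
    using norm_eq_zero_iff[OF W_norms[OF that]] that
    by (auto simp: abs_sum_norm_def fun_eq_iff NX_eq_zero W_coord)
  show "NW (c *\<^sub>R x) = \<bar>c\<bar> * NW x" if "x \<in> W" for c x
    using norm_scale[OF W_norms[OF that], of "\<bar>c\<bar>"] scale[OF that]
    by (simp add: abs_sum_norm_def)
  show "NW (x + y) \<le> NW x + NW y" if "x \<in> W" "y \<in> W" for x y
    using add[OF that] by blast
qed

sublocale sum: normed_space W NW
  by (rule normed_space_W)

lemma NX_le_NW: "x \<in> W \<Longrightarrow> NX i (x i) \<le> NW x"
  using coordinate_le[OF W_norms, of x i] NX_nonneg[OF W_coord, of x i]
  by (simp add: abs_sum_norm_def)

lemma restr_in: "x \<in> W \<Longrightarrow> restr K x \<in> W"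
  and norm_restr_le: "x \<in> W \<Longrightarrow> NW (restr K x) \<le> NW x"
  using W_solid[of "restr K x" "\<lambda>i. NX i (x i)"]
  by (auto simp: restr_def X_zero W_coord NX_zero W_norms NX_nonneg abs_sum_norm_def)

lemma restr_finite_in:
  assumes "finite K" "\<And>i. i \<in> K \<Longrightarrow> x i \<in> X i"
  shows "restr K x \<in> W"
proof -
  have "{i. NX i (restr K x i) \<noteq> 0} \<subseteq> K"
    by (auto simp: restr_def NX_zero)
  then have "(\<lambda>i. NX i (restr K x i)) \<in> E"
    using assms(1) by (intro finite_support_in) (rule finite_subset)
  then show ?thesis
    using assms by (auto simp: abs_sum_def restr_def X_zero)
qed

lemma restr_singleton: "restr {i} (\<lambda>_. x i) = restr {i} x"
  by (auto simp: restr_def)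

text \<open>The normalisation of the unit functions makes the embedding of each summand isometric,
  so a functional on the sum restricts to the summands with the same bound.\<close>

lemma norm_restr_singleton:
  assumes "u \<in> X i"
  shows "NW (restr {i} (\<lambda>_. u)) = NX i u"
proof -
  have "(\<lambda>j. NX j (restr {i} (\<lambda>_. u) j)) = NX i u *\<^sub>R unit_fun i"
    by (auto simp: restr_def unit_fun_def scaleR_fun_def NX_zero)
  then show ?thesis
    by (simp add: abs_sum_norm_def norm_scale unit_fun_in norm_unit_fun NX_nonneg assms)
qed

lemma coordinate_functional:
  assumes f: "bounded_functional W NW f"
  shows "bounded_functional (X i) (NX i) (\<lambda>u. f (restr {i} (\<lambda>_. u)))"
proof -
  have in_W: "restr {i} (\<lambda>_. u) \<in> W" if "u \<in> X i" for u
    using that by (intro restr_finite_in) auto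
  have "restr {i} (\<lambda>_. u + v) = restr {i} (\<lambda>_. u) + restr {i} (\<lambda>_. v)"
    "restr {i} (\<lambda>_. k *\<^sub>R u) = k *\<^sub>R restr {i} (\<lambda>_. u)" for k and u v :: 'a
    by (auto simp: restr_def scaleR_fun_def)
  moreover obtain C where "\<And>x. x \<in> W \<Longrightarrow> \<bar>f x\<bar> \<le> C * NW x"
    using f unfolding bounded_functional_def by blast
  then have "\<bar>f (restr {i} (\<lambda>_. u))\<bar> \<le> C * NX i u" if "u \<in> X i" for u
    using in_W[OF that] norm_restr_singleton[OF that] by metis
  then have "\<exists>C. \<forall>u\<in>X i. \<bar>f (restr {i} (\<lambda>_. u))\<bar> \<le> C * NX i u"
    by blast
  ultimately show ?thesis
    using f in_W unfolding bounded_functional_def by auto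
qed

text \<open>Induction on \<open>K\<close> gives this for finite sets. Vectors with infinite support
  are reached through \<open>functional_tail\<close>.\<close>

lemma additive_restr:
  assumes f: "bounded_functional W NW f" and K: "finite K"
    and x: "\<And>i. i \<in> K \<Longrightarrow> x i \<in> X i"
  shows "f (restr K x) = (\<Sum>i\<in>K. f (restr {i} x))"
  using K x
proof (induction rule: finite_induct)
  case empty
  have "f (0 *\<^sub>R 0) = 0 * f 0"
    using f sum.zero_in unfolding bounded_functional_def by blast
  then show ?case
    by (simp add: restr_def zero_fun_def)
next
  case (insert i K)
  have "restr (insert i K) x = restr {i} x + restr K x"
    using insert.hyps by (auto simp: restr_def)
  then have "f (restr (insert i K) x) = f (restr {i} x) + f (restr K x)"
    using f insert restr_finite_in[of "{i}" x] restr_finite_in[of K x]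
    unfolding bounded_functional_def by auto
  with insert show ?case by simp
qed

section \<open>Completeness of the absolute sum\<close>

text \<open>A Cauchy sequence converges in each coordinate, to \<open>l\<close> say. For fixed
  \<open>w\<close> in the sum, the norm families of \<sigma> m - w are Cauchy in E and converge
  pointwise to that of l - w, so \<open>pointwise_limit\<close> applies. Taking w = 0 shows that
  \<open>l\<close> lies in the sum, and w = \<sigma> n yields convergence in norm.\<close>

lemma banach_space_W:
  assumes banach: "\<And>i. banach_space (X i) (NX i)"
  shows "banach_space W NW"
  unfolding banach_space_iff
proof (intro conjI normed_space_W allI impI)
  fix \<sigma> :: "nat \<Rightarrow> 'i \<Rightarrow> 'a"
  assume \<sigma>: "\<forall>n. \<sigma> n \<in> W"
    and cauchy: "\<forall>e>0. \<exists>M. \<forall>m\<ge>M. \<forall>n\<ge>M. NW (\<sigma> m - \<sigma> n) < e"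
  have \<sigma>X: "\<sigma> n i \<in> X i" for n i
    using \<sigma> W_coord by blast
  have coord: "NX i (\<sigma> m i - \<sigma> n i) \<le> NW (\<sigma> m - \<sigma> n)" for i m n
    using NX_le_NW[OF sum.diff_in, of "\<sigma> m" "\<sigma> n" i] \<sigma> by simp
  have "\<exists>l\<in>X i. (\<lambda>n. NX i (\<sigma> n i - l)) \<longlonglongrightarrow> 0" for i
  proof -
    have "\<exists>M. \<forall>m\<ge>M. \<forall>n\<ge>M. NX i (\<sigma> m i - \<sigma> n i) < e" if "0 < e" for e
      using cauchy coord[of i] that by (meson le_less_trans)
    from banach_space_convergent[of "X i" "NX i" "\<lambda>n. \<sigma> n i", OF banach \<sigma>X this]
    show ?thesis by blast
  qed
  then obtain l where l: "\<And>i. l i \<in> X i" and lim: "\<And>i. (\<lambda>n. NX i (\<sigma> n i - l i)) \<longlonglongrightarrow> 0"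
    by metis
  have dist_lim: "(\<lambda>m. NX i (\<sigma> m i - w)) \<longlonglongrightarrow> NX i (l i - w)" if "w \<in> X i" for i w
  proof -
    have "\<bar>NX i (\<sigma> m i - w) - NX i (l i - w)\<bar> \<le> NX i (\<sigma> m i - l i)" for m
      using normed_space.norm_diff_triangle[OF summand X_diff[OF \<sigma>X that] X_diff[OF l that], of m]
      by simp
    then have "(\<lambda>m. NX i (\<sigma> m i - w) - NX i (l i - w)) \<longlonglongrightarrow> 0"
      by (intro Lim_null_comparison[OF _ lim[of i]] always_eventually) auto
    then show ?thesis
      by (simp add: LIM_zero_iff)
  qed
  have shifted: "(\<lambda>i. NX i (l i - w i)) \<in> E \<and>
      (\<lambda>m. NE ((\<lambda>i. NX i (\<sigma> m i - w i)) - (\<lambda>i. NX i (l i - w i)))) \<longlonglongrightarrow> 0" if w: "w \<in> W" for w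
  proof -
    define b where "b m = (\<lambda>i. NX i (\<sigma> m i - w i))" for m
    have bE: "b m \<in> E" for m
      using W_norms[OF sum.diff_in, of "\<sigma> m" w] \<sigma> w by (simp add: b_def)
    have "NE (b m - b n) \<le> NW (\<sigma> m - \<sigma> n)" for m n
    proof -
      have "\<bar>(b m - b n) i\<bar> \<le> \<bar>NX i ((\<sigma> m - \<sigma> n) i)\<bar>" for i
        using normed_space.norm_diff_triangle[OF summand X_diff[OF \<sigma>X W_coord[OF w]]
            X_diff[OF \<sigma>X W_coord[OF w]], of i m n]
        by (simp add: b_def)
      then show ?thesis
        using solid[of "b m - b n", OF _ W_norms[OF sum.diff_in]] \<sigma>
        unfolding abs_sum_norm_def by blast
    qed
    then have cauchy': "\<exists>M. \<forall>m\<ge>M. \<forall>n\<ge>M. NE (b m - b n) < e" if "0 < e" for e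
      using cauchy that by (meson le_less_trans)
    have "(\<lambda>m. b m i) \<longlonglongrightarrow> NX i (l i - w i)" for i
      using dist_lim[OF W_coord[OF w]] by (simp add: b_def)
    from pointwise_limit[of b, OF bE cauchy' this] show ?thesis
      by (simp add: b_def)
  qed
  have lW: "l \<in> W"
    using shifted[OF sum.zero_in] l by (simp add: abs_sum_def)
  moreover have "(\<lambda>n. NW (\<sigma> n - l)) \<longlonglongrightarrow> 0"
  proof (rule LIMSEQ_I)
    fix e :: real assume e: "0 < e"
    then obtain M where M: "\<And>m n. M \<le> m \<Longrightarrow> M \<le> n \<Longrightarrow> NW (\<sigma> m - \<sigma> n) < e / 2"
      using cauchy half_gt_zero by meson
    have "NW (\<sigma> n - l) < e" if n: "M \<le> n" for n
    proof -
      define b where "b m = (\<lambda>i. NX i (\<sigma> m i - \<sigma> n i))" for m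
      define c where "c = (\<lambda>i. NX i (l i - \<sigma> n i))"
      have \<sigma>n: "\<sigma> n \<in> W" and c: "c \<in> E" "(\<lambda>m. NE (b m - c)) \<longlonglongrightarrow> 0"
        using shifted \<sigma> unfolding b_def c_def by auto
      obtain K where K: "\<And>m. K \<le> m \<Longrightarrow> \<bar>NE (b m - c)\<bar> < e / 2"
        using LIMSEQ_D[OF c(2), of "e / 2"] e by auto
      \<comment> \<open>Beyond \<open>M\<close> the Cauchy condition bounds \<open>NE (b m)\<close>
        by e / 2, and beyond \<open>K\<close> the distance from \<open>b m\<close> to
        \<open>c\<close> is below e / 2.\<close>
      define m where "m = max K M"
      have bm: "b m \<in> E" "NE (b m) < e / 2"
        using W_norms[OF sum.diff_in, of "\<sigma> m" "\<sigma> n"] \<sigma> M[of m n] n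
        by (auto simp: b_def m_def abs_sum_norm_def)
      have "NW (\<sigma> n - l) = NE c"
        using sum.norm_diff_commute[OF \<sigma>n lW] by (simp add: c_def abs_sum_norm_def)
      also have "\<dots> \<le> NE (b m) + NE (b m - c)"
        using norm_diff_triangle[OF bm(1) c(1)] by simp
      finally show ?thesis
        using bm K[of m] by (simp add: m_def)
    qed
    then show "\<exists>M. \<forall>n\<ge>M. norm (NW (\<sigma> n - l) - 0) < e"
      using sum.norm_nonneg[OF sum.diff_in] \<sigma> lW by auto
  qed
  ultimately show "\<exists>x\<in>W. (\<lambda>n. NW (\<sigma> n - x)) \<longlonglongrightarrow> 0" by blast
qed

section \<open>The octahedral direction built from weights\<close>

text \<open>Here \<open>\<phi>\<close> is a positive functional of norm at most 1 on E dominating \<open>f\<close>, almost normed by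
  the finitely supported unit vector \<open>a\<close>.\<close>

lemma octahedral_direction:
  assumes wo: "\<And>i. weakly_octahedral (X i) (NX i)"
    and f: "bounded_functional W NW f"
    and tail: "\<And>x e. x \<in> W \<Longrightarrow> 0 < e \<Longrightarrow> \<exists>K. finite K \<and> \<bar>f x - f (restr K x)\<bar> < e"
    and F: "finite F" "F \<subseteq> W"
    and \<delta>: "0 < \<delta>" "\<delta> < 1"
    and \<phi>: "\<And>i. 0 \<le> \<phi> i" "\<And>i x. x i \<in> X i \<Longrightarrow> \<bar>f (restr {i} x)\<bar> \<le> \<phi> i * NX i (x i)"
    and \<phi>_le: "\<And>x K. finite K \<Longrightarrow> x \<in> W \<Longrightarrow> (\<Sum>i\<in>K. \<phi> i * NX i (x i)) \<le> NW x"
    and J: "finite J" "\<And>i. i \<notin> J \<Longrightarrow> a i = 0"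
    and a: "\<And>i. 0 \<le> a i" "NE a = 1" "\<And>i. a i \<noteq> 0 \<Longrightarrow> \<exists>z\<in>X i. z \<noteq> 0"
    and almost: "1 - \<delta> \<le> (\<Sum>i\<in>J. \<phi> i * a i)"
  shows "\<exists>y\<in>unit_sphere W NW. \<forall>x\<in>F. \<forall>t>0.
    (1 - \<delta>) * (\<bar>f x\<bar> + (1 - \<delta>) * t) \<le> NW (x + t *\<^sub>R y)"
proof -
  \<comment> \<open>One direction per summand must serve all x in F and all t at once. Where
    \<open>a i = 0\<close> the direction is multiplied by zero, so 0 is good enough and a trivial
    summand does no harm.\<close>
  have "\<exists>v. v \<in> X i \<and> (a i \<noteq> 0 \<longrightarrow> NX i v = 1) \<and> (\<forall>x\<in>F. \<forall>t\<ge>0. a i \<noteq> 0 \<longrightarrow>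
      (1 - \<delta>) * (\<bar>f (restr {i} x)\<bar> + \<phi> i * t) \<le> \<phi> i * NX i (x i + t *\<^sub>R v))" for i
  proof (cases "a i = 0")
    case True
    then show ?thesis
      using X_zero by auto
  next
    case False
    then obtain z where z: "z \<in> X i" "z \<noteq> 0"
      using a(3) by blast
    define g where "g u = f (restr {i} (\<lambda>_. u))" for u
    have g: "bounded_functional (X i) (NX i) g"
      using coordinate_functional[OF f] by (simp add: g_def[abs_def])
    have g_restr: "f (restr {i} x) = g (x i)" for x
      by (simp add: g_def restr_singleton)
    have g_bound: "\<bar>g u\<bar> \<le> \<phi> i * NX i u" if "u \<in> X i" for u
      using \<phi>(2)[of "\<lambda>_. u" i] that by (simp add: g_def)
    have fin: "finite ((\<lambda>x. x i) ` F)" "(\<lambda>x. x i) ` F \<subseteq> X i"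
      using F W_coord by auto
    obtain v where "v \<in> X i" "NX i v = 1"
      "\<And>u t. u \<in> (\<lambda>x. x i) ` F \<Longrightarrow> 0 \<le> t \<Longrightarrow>
         (1 - \<delta>) * (\<bar>g u\<bar> + \<phi> i * t) \<le> \<phi> i * NX i (u + t *\<^sub>R v)"
      using weakly_octahedral_scaled[of "X i" "NX i" "(\<lambda>x. x i) ` F" z "\<phi> i" g,
          OF wo fin z \<phi>(1) _ _ g_bound \<delta>] g
      unfolding bounded_functional_def by metis
    then show ?thesis
      by (auto simp: g_restr)
  qed
  then obtain v where v: "\<And>i. v i \<in> X i" "\<And>i. a i \<noteq> 0 \<Longrightarrow> NX i (v i) = 1"
    and v_ineq: "\<And>i x t. x \<in> F \<Longrightarrow> 0 \<le> t \<Longrightarrow> a i \<noteq> 0 \<Longrightarrow>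
      (1 - \<delta>) * (\<bar>f (restr {i} x)\<bar> + \<phi> i * t) \<le> \<phi> i * NX i (x i + t *\<^sub>R v i)"
    by metis
  define y where "y = (\<lambda>i. a i *\<^sub>R v i)"
  have norms_y: "(\<lambda>i. NX i (y i)) = a"
    using v a(1) by (auto simp: y_def NX_scale fun_eq_iff)
  have yW: "y \<in> W"
  proof -
    have "restr J y = y"
      using J(2) by (auto simp: restr_def y_def fun_eq_iff)
    then show ?thesis
      using restr_finite_in[OF J(1), of y] v(1) by (simp add: y_def X_scale)
  qed
  have "NW y = 1"
    by (simp add: abs_sum_norm_def norms_y a(2))
  with yW have "y \<in> unit_sphere W NW"
    by (simp add: unit_sphere_def)
  moreover have "(1 - \<delta>) * (\<bar>f x\<bar> + (1 - \<delta>) * t) \<le> NW (x + t *\<^sub>R y)" if xF: "x \<in> F" and t: "0 < t" for x t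
  \<comment> \<open>Since \<open>x\<close> may have infinite support, \<open>f x\<close> is known
    only up to a tail error, absorbed by \<open>e\<close>. The set \<open>K\<close> depends on
    \<open>e\<close>, but \<open>y\<close> does not.\<close>
  proof (rule field_le_epsilon)
    fix e :: real assume e: "0 < e"
    have xW: "x \<in> W"
      using xF F by blast
    obtain K where K: "finite K" "\<bar>f x - f (restr K x)\<bar> < e"
      using tail[OF xW e] by blast
    \<comment> \<open>Large enough to carry both most of \<open>f x\<close> and the support of
      \<open>y\<close>.\<close>
    define K' where "K' = K \<union> J"
    \<comment> \<open>The i-th coordinate of t y is t a(i) v(i), hence the parameter
      \<open>t * a i\<close>. Where \<open>a i = 0\<close>, the domination of \<open>f\<close> by
      \<phi> suffices.\<close>
    have step: "(1 - \<delta>) * (\<bar>f (restr {i} x)\<bar> + \<phi> i * (t * a i)) \<le> \<phi> i * NX i ((x + t *\<^sub>R y) i)" for i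
    proof (cases "a i = 0")
      case True
      have "(1 - \<delta>) * \<bar>f (restr {i} x)\<bar> \<le> 1 * \<bar>f (restr {i} x)\<bar>"
        using \<delta> by (intro mult_right_mono) auto
      also have "\<dots> \<le> \<phi> i * NX i (x i)"
        using \<phi>(2)[of x i, OF W_coord[OF xW]] by simp
      finally show ?thesis
        using True by (simp add: y_def scaleR_fun_def)
    next
      case False
      then show ?thesis
        using v_ineq[OF xF, of "t * a i" i] t a(1)[of i] by (simp add: y_def scaleR_fun_def)
    qed
    have "\<bar>f (restr K x)\<bar> \<le> (\<Sum>i\<in>K. \<bar>f (restr {i} x)\<bar>)"
      using additive_restr[OF f K(1), of x] W_coord[OF xW] by simp
    also have "\<dots> \<le> (\<Sum>i\<in>K'. \<bar>f (restr {i} x)\<bar>)"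
      using K J by (intro sum_mono2) (auto simp: K'_def)
    finally have 1: "\<bar>f x\<bar> - e \<le> (\<Sum>i\<in>K'. \<bar>f (restr {i} x)\<bar>)"
      using K(2) by linarith
    have "(\<Sum>i\<in>J. \<phi> i * a i) \<le> (\<Sum>i\<in>K'. \<phi> i * a i)"
      using K J \<phi>(1) a(1) by (intro sum_mono2) (auto simp: K'_def)
    with almost have "1 - \<delta> \<le> (\<Sum>i\<in>K'. \<phi> i * a i)"
      by linarith
    then have "t * (1 - \<delta>) \<le> t * (\<Sum>i\<in>K'. \<phi> i * a i)"
      using t by simp
    also have "\<dots> = (\<Sum>i\<in>K'. \<phi> i * (t * a i))"
      by (simp add: sum_distrib_left mult_ac)
    finally have "\<bar>f x\<bar> - e + (1 - \<delta>) * t \<le> (\<Sum>i\<in>K'. \<bar>f (restr {i} x)\<bar> + \<phi> i * (t * a i))"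
      using 1 by (simp add: sum.distrib mult.commute)
    then have "(1 - \<delta>) * (\<bar>f x\<bar> - e + (1 - \<delta>) * t)
        \<le> (1 - \<delta>) * (\<Sum>i\<in>K'. \<bar>f (restr {i} x)\<bar> + \<phi> i * (t * a i))"
      using \<delta> by simp
    also have "\<dots> \<le> (\<Sum>i\<in>K'. \<phi> i * NX i ((x + t *\<^sub>R y) i))"
      unfolding sum_distrib_left by (intro sum_mono step)
    also have "\<dots> \<le> NW (x + t *\<^sub>R y)"
      using K J xW yW by (intro \<phi>_le sum.add_in sum.scale_in) (auto simp: K'_def)
    finally have "(1 - \<delta>) * (\<bar>f x\<bar> - e + (1 - \<delta>) * t) \<le> NW (x + t *\<^sub>R y)" .
    moreover have "(1 - \<delta>) * (\<bar>f x\<bar> - e + (1 - \<delta>) * t)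
        = (1 - \<delta>) * (\<bar>f x\<bar> + (1 - \<delta>) * t) - (1 - \<delta>) * e"
      by (simp add: algebra_simps)
    moreover have "(1 - \<delta>) * e \<le> 1 * e"
      using \<delta> e by (intro mult_right_mono) auto
    ultimately show "(1 - \<delta>) * (\<bar>f x\<bar> + (1 - \<delta>) * t) \<le> NW (x + t *\<^sub>R y) + e"
      by linarith
  qed
  ultimately show ?thesis by blast
qed


section \<open>Norms of the coordinate functionals, tails and norming weights\<close>

text \<open>Choose a nearly norming vector in the unit ball of each summand, scale it by the norm of
  the i-th coordinate of \<open>x\<close>, and glue over \<open>K\<close>. By solidity the result
  has norm at most \<open>NW x\<close>, while \<open>f\<close> takes almost the value of the
  left-hand sum there.\<close>

lemma sum_dual_norms_le:
  assumes f: "bounded_functional W NW f" and K: "finite K" and x: "x \<in> W"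
  shows "(\<Sum>i\<in>K. dual_norm (X i) (NX i) (\<lambda>u. f (restr {i} (\<lambda>_. u))) * NX i (x i))
    \<le> dual_norm W NW f * NW x"
proof (rule field_le_epsilon)
  fix e :: real assume e: "0 < e"
  define g where "g i = (\<lambda>u. f (restr {i} (\<lambda>_. u)))" for i
  define r where "r i = NX i (x i)" for i
  have g: "bounded_functional (X i) (NX i) (g i)" for i
    unfolding g_def by (rule coordinate_functional[OF f])
  have r: "0 \<le> r i" for i
    by (simp add: r_def NX_nonneg W_coord[OF x])
  \<comment> \<open>An error of e / S per summand, weighted by \<open>r i\<close>, adds up to at
    most \<open>e\<close>. The added 1 keeps \<open>S\<close> positive if all \<open>r i\<close>
    vanish.\<close>
  define S where "S = (\<Sum>i\<in>K. r i) + 1"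
  have S: "0 < S"
    using r by (simp add: S_def add_nonneg_pos sum_nonneg)
  have "\<exists>u. u \<in> X i \<and> NX i u \<le> 1 \<and> dual_norm (X i) (NX i) (g i) - e / S < g i u" for i
    using normed_space.dual_norm_approx[OF summand g, of "dual_norm (X i) (NX i) (g i) - e / S" i]
      e S by (metis diff_less_eq divide_pos_pos less_add_same_cancel1)
  then obtain u where u: "\<And>i. u i \<in> X i" "\<And>i. NX i (u i) \<le> 1"
    and u_ineq: "\<And>i. dual_norm (X i) (NX i) (g i) - e / S < g i (u i)"
    by metis
  define w where "w = (\<lambda>i. r i *\<^sub>R u i)"
  have w: "w i \<in> X i" for i
    by (simp add: w_def X_scale u)
  have w_norm: "NX i (w i) \<le> r i" for i
    using mult_left_mono[OF u(2) r, of i i] by (simp add: w_def NX_scale u r)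
  have rE: "r \<in> E"
    using W_norms[OF x] by (simp add: r_def[abs_def])
  have wW: "restr K w \<in> W" "NW (restr K w) \<le> NE r"
    using W_solid[of "restr K w" r, OF _ rE] w w_norm r
    by (auto simp: restr_def X_zero NX_zero)
  have "f (restr K w) = (\<Sum>i\<in>K. g i (w i))"
    using additive_restr[OF f K w] by (simp add: g_def restr_singleton)
  also have "\<dots> = (\<Sum>i\<in>K. r i * g i (u i))"
    using g u(1) by (intro sum.cong) (auto simp: w_def bounded_functional_def)
  also have "\<dots> \<ge> (\<Sum>i\<in>K. r i * (dual_norm (X i) (NX i) (g i) - e / S))"
    using u_ineq r by (intro sum_mono mult_left_mono) (auto intro: less_imp_le)
  finally have "(\<Sum>i\<in>K. dual_norm (X i) (NX i) (g i) * r i) - (\<Sum>i\<in>K. r i) * (e / S) \<le> f (restr K w)"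
    by (simp only: right_diff_distrib sum_subtractf sum_distrib_right mult.commute)
  moreover have "(\<Sum>i\<in>K. r i) * (e / S) \<le> S * (e / S)"
    using e S by (intro mult_right_mono) (auto simp: S_def)
  moreover have "S * (e / S) = e"
    using S by simp
  moreover have "f (restr K w) \<le> dual_norm W NW f * NW (restr K w)"
    using sum.dual_norm_bound[OF f wW(1)] by linarith
  moreover have "\<dots> \<le> dual_norm W NW f * NE r"
    using wW(2) by (intro mult_left_mono sum.dual_norm_nonneg[OF f])
  ultimately have "(\<Sum>i\<in>K. dual_norm (X i) (NX i) (g i) * r i) \<le> dual_norm W NW f * NE r + e"
    by linarith
  then show "(\<Sum>i\<in>K. dual_norm (X i) (NX i) (\<lambda>u. f (restr {i} (\<lambda>_. u))) * NX i (x i))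
      \<le> dual_norm W NW f * NW x + e"
    by (simp add: g_def r_def[abs_def] abs_sum_norm_def)
qed

text \<open>Let \<open>s\<close> be finitely supported and close to the norm family \<open>a\<close>
  of \<open>x\<close>. Off the support of \<open>s\<close>, the families \<open>a\<close> and
  \<open>a - s\<close> agree, so by solidity the tail of \<open>x\<close> is no larger than
  \<open>a - s\<close>, and \<open>f\<close> is continuous.\<close>

lemma functional_tail:
  assumes dense: "mtopology closure_of (span (range unit_fun)) = E"
    and f: "bounded_functional W NW f" and x: "x \<in> W" and e: "0 < e"
  shows "\<exists>K. finite K \<and> \<bar>f x - f (restr K x)\<bar> < e"
proof -
  \<comment> \<open>The added 1 allows division by \<open>C\<close> even if \<open>f\<close> has
    norm zero.\<close>
  define C where "C = dual_norm W NW f + 1"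
  have C: "0 < C"
    using sum.dual_norm_nonneg[OF f] by (simp add: C_def)
  define a where "a = (\<lambda>i. NX i (x i))"
  have aE: "a \<in> E"
    using W_norms[OF x] by (simp add: a_def)
  then have "a \<in> mtopology closure_of (span (range unit_fun))"
    using dense by simp
  then obtain s where s: "s \<in> span (range unit_fun)" "s \<in> E" "NE (a - s) < e / C"
    using C e aE unfolding metric_closure_of
    by (force simp: in_mball norm_dist_def dest: spec[of _ "e / C"])
  define K where "K = {i. s i \<noteq> 0}"
  have K: "finite K"
    unfolding K_def by (rule span_unit_fun_finite_support[OF s(1)])
  have as: "a - s \<in> E"
    by (rule diff_in[OF aE s(2)])
  have tail: "x - restr K x \<in> W"
    by (intro sum.diff_in restr_in x)
  have "NX i ((x - restr K x) i) \<le> \<bar>(a - s) i\<bar>" for i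
    by (auto simp: restr_def K_def a_def NX_zero)
  then have "NW (x - restr K x) \<le> NE (a - s)"
    using W_solid(2)[OF W_coord[OF tail] as] by blast
  have "\<bar>f x - f (restr K x)\<bar> = \<bar>f (x - restr K x)\<bar>"
    using sum.bounded_functional_diff[OF f x restr_in[OF x]] by simp
  also have "\<dots> \<le> dual_norm W NW f * NW (x - restr K x)"
    by (rule sum.dual_norm_bound[OF f tail])
  also have "\<dots> \<le> C * NE (a - s)"
    using \<open>NW (x - restr K x) \<le> NE (a - s)\<close> C
    by (intro mult_mono sum.norm_nonneg tail) (auto simp: C_def)
  also have "\<dots> < C * (e / C)"
    using s(3) C by (intro mult_strict_left_mono)
  also have "\<dots> = e"
    using C by simp
  finally show ?thesis
    using K by blast
qed

text \<open>Supplies the data that \<open>octahedral_direction\<close> requires. After division by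
  the norm of \<open>f\<close>, \<open>sum_dual_norms_le\<close> says that \<phi> has norm at most 1
  on E.\<close>

lemma norming_weights:
  assumes dense: "mtopology closure_of (span (range unit_fun)) = E"
    and f: "f \<in> dual_unit_ball W NW" and \<delta>: "0 < \<delta>" "\<delta> < 1"
    and x0: "x0 \<in> unit_sphere W NW"
  obtains \<phi> a J where "\<And>i. (0::real) \<le> \<phi> i"
    "\<And>i x. x i \<in> X i \<Longrightarrow> \<bar>f (restr {i} x)\<bar> \<le> \<phi> i * NX i (x i)"
    "\<And>x K. finite K \<Longrightarrow> x \<in> W \<Longrightarrow> (\<Sum>i\<in>K. \<phi> i * NX i (x i)) \<le> NW x"
    "finite J" "\<And>i. i \<notin> J \<Longrightarrow> a i = 0" "\<And>i. 0 \<le> a i" "NE a = 1"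
    "\<And>i. a i \<noteq> 0 \<Longrightarrow> \<exists>z\<in>X i. z \<noteq> 0" "1 - \<delta> \<le> (\<Sum>i\<in>J. \<phi> i * a i)"
proof -
  define L where "L = dual_norm W NW f"
  have bf: "bounded_functional W NW f" and L1: "L \<le> 1"
    using f by (auto simp: dual_unit_ball_def L_def)
  have L0: "0 \<le> L"
    unfolding L_def by (rule sum.dual_norm_nonneg[OF bf])
  have single_in: "restr {i} x \<in> W" if "x i \<in> X i" for i x
    using that by (intro restr_finite_in) auto
  show thesis
  proof (cases "L = 0")
    case True
    have f0: "f (restr {i} x) = 0" if "x i \<in> X i" for i x
      using sum.dual_norm_bound[OF bf single_in[of x i, OF that]] True by (simp add: L_def)
    have x0': "x0 \<in> W" "x0 \<noteq> 0"
      using x0 sum.norm_zero by (auto simp: unit_sphere_def)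
    then obtain i where i: "x0 i \<noteq> 0"
      by (auto simp: fun_eq_iff)
    show thesis
    \<comment> \<open>With \<open>f\<close> zero on every summand, any weights dominate it. The
      coordinate \<open>i\<close> is one where \<open>x0\<close> is non-zero, so the i-th summand
      has a non-zero vector, and the pairing of \<phi> with \<open>a\<close> equals 1.\<close>
    proof (rule that[of "unit_fun i" "{i}" "unit_fun i"])
      show "(\<Sum>j\<in>K. unit_fun i j * NX j (x j)) \<le> NW x" if "finite K" "x \<in> W" for x K
      proof -
        have "(\<Sum>j\<in>K. unit_fun i j * NX j (x j)) = (\<Sum>j\<in>K. if j = i then NX i (x i) else 0)"
          by (intro sum.cong) (auto simp: unit_fun_def)
        also have "\<dots> \<le> NW x"
          using that NX_le_NW[of x i] sum.norm_nonneg[of x] by auto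
        finally show ?thesis .
      qed
      show "\<exists>z\<in>X j. z \<noteq> 0" if "unit_fun i j \<noteq> 0" for j
        using that i W_coord[OF x0'(1)] by (auto simp: unit_fun_def split: if_splits)
      show "\<bar>f (restr {j} x)\<bar> \<le> unit_fun i j * NX j (x j)" if "x j \<in> X j" for j x
        using that by (simp add: f0 unit_fun_def NX_nonneg)
    qed (use \<delta> in \<open>auto simp: unit_fun_def norm_unit_fun[unfolded unit_fun_def]\<close>)
  next
    case False
    with L0 have L: "0 < L" by simp
    define g where "g i = (\<lambda>u. f (restr {i} (\<lambda>_. u)))" for i
    define \<phi> where "\<phi> i = dual_norm (X i) (NX i) (g i) / L" for i
    have g: "bounded_functional (X i) (NX i) (g i)" for i
      unfolding g_def by (rule coordinate_functional[OF bf])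
    have \<phi>_nonneg: "0 \<le> \<phi> i" for i
      using normed_space.dual_norm_nonneg[OF summand g] L by (simp add: \<phi>_def)
    have g_le: "\<bar>f (restr {i} x)\<bar> \<le> L * (\<phi> i * NX i (x i))" if "x i \<in> X i" for i x
      using normed_space.dual_norm_bound[OF summand g that] L
      by (simp add: g_def restr_singleton \<phi>_def)
    \<comment> \<open>The loss \<delta> is split in two: one half for the nearly norming
      \<open>z0\<close>, the other for its truncation to \<open>J\<close>.\<close>
    have "L * (1 - \<delta> / 2) < L * 1"
      using L \<delta> by (intro mult_strict_left_mono) auto
    then obtain z0 where z0: "z0 \<in> W" "NW z0 \<le> 1" "L * (1 - \<delta> / 2) < f z0"
      using sum.dual_norm_approx[OF bf, of "L * (1 - \<delta> / 2)"] by (auto simp: L_def)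
    obtain J where J: "finite J" "\<bar>f z0 - f (restr J z0)\<bar> < L * (\<delta> / 2)"
      using functional_tail[OF dense bf z0(1), of "L * (\<delta> / 2)"] L \<delta> by auto
    define z1 where "z1 = restr J z0"
    define r where "r = NW z1"
    have "L * (1 - \<delta> / 2) = L * (1 - \<delta>) + L * (\<delta> / 2)"
      by (simp add: algebra_simps)
    then have "L * (1 - \<delta>) < f z1"
      using z0(3) J(2) unfolding z1_def by linarith
    then have z1: "z1 \<in> W" "r \<le> 1" "L * (1 - \<delta>) < f z1"
      using z0 restr_in[OF z0(1), of J] norm_restr_le[OF z0(1), of J]
      by (auto simp: z1_def r_def)
    have "0 < L * (1 - \<delta>)"
      using L \<delta> by simp
    then have f_pos: "0 < f z1"
      using z1 by linarith
    have r: "0 < r"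
    proof (rule ccontr)
      assume "\<not> 0 < r"
      then have "r = 0"
        using sum.norm_nonneg[OF z1(1)] by (simp add: r_def)
      then show False
        using sum.dual_norm_bound[OF bf z1(1)] f_pos by (simp add: r_def)
    qed
    \<comment> \<open>Since 0 < r \<le> 1 and \<open>f z1\<close> is positive, passing to norm 1
      does not decrease the value of \<open>f\<close>.\<close>
    define z where "z = (1 / r) *\<^sub>R z1"
    define a where "a i = NX i (z i)" for i
    have z: "z \<in> W" "NW z = 1"
      using r sum.norm_scale[OF z1(1), of "1 / r"] sum.scale_in[OF z1(1), of "1 / r"]
      by (auto simp: z_def r_def)
    have "f z = 1 / r * f z1"
      using bf z1(1) unfolding z_def bounded_functional_def by blast
    moreover have "1 * f z1 \<le> 1 / r * f z1"
      using r z1(2) f_pos by (intro mult_right_mono) auto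
    ultimately have fz: "L * (1 - \<delta>) \<le> f z"
      using z1(3) by linarith
    have z_supp: "z i = 0" if "i \<notin> J" for i
      using that by (simp add: z_def z1_def restr_def scaleR_fun_def)
    have "restr J z = z"
      using z_supp by (auto simp: restr_def)
    then have "f z = (\<Sum>i\<in>J. f (restr {i} z))"
      using additive_restr[OF bf J(1), of z] W_coord[OF z(1)] by simp
    also have "\<dots> \<le> (\<Sum>i\<in>J. L * (\<phi> i * a i))"
      using g_le[of z, OF W_coord[OF z(1)]] by (intro sum_mono) (auto simp: a_def abs_le_iff)
    also have "\<dots> = L * (\<Sum>i\<in>J. \<phi> i * a i)"
      by (simp add: sum_distrib_left)
    finally have almost: "1 - \<delta> \<le> (\<Sum>i\<in>J. \<phi> i * a i)"
      using fz L by (meson mult_le_cancel_left_pos order_trans)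
    show thesis
    proof (rule that[OF \<phi>_nonneg _ _ J(1) _ _ _ _ almost])
      show "\<bar>f (restr {i} x)\<bar> \<le> \<phi> i * NX i (x i)" if "x i \<in> X i" for i x
      proof -
        \<comment> \<open>Dividing by \<open>L\<close> \<le> 1 can only enlarge the weights, so they
          still dominate \<open>f\<close>.\<close>
        have "L * (\<phi> i * NX i (x i)) \<le> 1 * (\<phi> i * NX i (x i))"
          using L1 \<phi>_nonneg NX_nonneg[OF that] by (intro mult_right_mono) auto
        then show ?thesis
          using g_le[of x i, OF that] by simp
      qed
      show "(\<Sum>i\<in>K. \<phi> i * NX i (x i)) \<le> NW x" if "finite K" "x \<in> W" for x K
      proof -
        have "L * (\<Sum>i\<in>K. \<phi> i * NX i (x i)) = (\<Sum>i\<in>K. dual_norm (X i) (NX i) (g i) * NX i (x i))"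
          using L by (simp add: sum_distrib_left \<phi>_def)
        also have "\<dots> \<le> L * NW x"
          using sum_dual_norms_le[OF bf that] by (simp add: g_def L_def)
        finally show ?thesis
          using L by simp
      qed
      show "a i = 0" if "i \<notin> J" for i
        using z_supp[OF that] by (simp add: a_def NX_zero)
      show "0 \<le> a i" for i
        by (simp add: a_def NX_nonneg W_coord[OF z(1)])
      show "NE a = 1"
        using z(2) by (simp add: a_def[abs_def] abs_sum_norm_def)
      show "\<exists>z\<in>X i. z \<noteq> 0" if "a i \<noteq> 0" for i
        using that W_coord[OF z(1), of i] by (intro bexI[of _ "z i"]) (auto simp: a_def NX_zero)
    qed
  qed
qed

end

theorem proposition5p4:
  fixes E :: "('i \<Rightarrow> real) set" and NE :: "('i \<Rightarrow> real) \<Rightarrow> real"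
    and X :: "'i \<Rightarrow> 'a::real_vector set" and NX :: "'i \<Rightarrow> 'a \<Rightarrow> real"
  assumes "absolute_norm E NE"
    and "Metric_space.mtopology E (norm_dist E NE) closure_of (span (range unit_fun)) = E"
    and "\<And>i. banach_space (X i) (NX i)"
    and "\<And>i. weakly_octahedral (X i) (NX i)"
  shows "weakly_octahedral (abs_sum E X NX) (abs_sum_norm NE NX)"
proof -
  interpret absolute_norm E NE by fact
  interpret absolute_sum E NE X NX
    using assms(3) by (intro absolute_sum.intro absolute_sum_axioms.intro assms(1))
      (simp add: banach_space_def)
  show ?thesis
    unfolding weakly_octahedral_def
  proof (intro conjI allI impI banach_space_W assms(3))
    fix F f and \<epsilon> :: real
    assume asm: "finite F \<and> F \<noteq> {} \<and> F \<subseteq> unit_sphere W NW \<and> f \<in> dual_unit_ball W NW \<and> 0 < \<epsilon>"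
    then have F: "finite F" "F \<subseteq> W" and bf: "bounded_functional W NW f"
      by (auto simp: unit_sphere_def dual_unit_ball_def)
    obtain x0 where x0: "x0 \<in> unit_sphere W NW"
      using asm by blast
    \<comment> \<open>Two factors 1 - \<delta> fall on t, one from the summands and one from the
      weights. As their product is at least 1 - 2\<delta>, the choice 2\<delta> \<le> \<epsilon>
      suffices, and the bound 1 / 2 ensures \<delta> < 1.\<close>
    define \<delta> where "\<delta> = min (\<epsilon> / 2) (1 / 2)"
    have \<delta>: "0 < \<delta>" "\<delta> < 1" "2 * \<delta> \<le> \<epsilon>"
      using asm by (auto simp: \<delta>_def)
    have "\<exists>y\<in>unit_sphere W NW. \<forall>x\<in>F. \<forall>t>0.
        (1 - \<delta>) * (\<bar>f x\<bar> + (1 - \<delta>) * t) \<le> NW (x + t *\<^sub>R y)"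
      using asm norming_weights[OF assms(2) _ \<delta>(1,2) x0]
        octahedral_direction[OF assms(4) bf functional_tail[OF assms(2) bf] F \<delta>(1,2)]
      by (smt (verit, best))
    moreover have "(1 - \<epsilon>) * (\<bar>f x\<bar> + t) \<le> (1 - \<delta>) * (\<bar>f x\<bar> + (1 - \<delta>) * t)" if "0 < t" for x t
    proof -
      have "(1 - \<epsilon>) * (\<bar>f x\<bar> + t) \<le> (1 - 2 * \<delta>) * (\<bar>f x\<bar> + t)"
        using \<delta> that by (intro mult_right_mono) auto
      moreover have "(1 - \<delta>) * (\<bar>f x\<bar> + (1 - \<delta>) * t)
          = (1 - 2 * \<delta>) * (\<bar>f x\<bar> + t) + \<delta> * \<bar>f x\<bar> + \<delta> * \<delta> * t"
        by (simp add: algebra_simps)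
      moreover have "0 \<le> \<delta> * \<bar>f x\<bar>" "0 \<le> \<delta> * \<delta> * t"
        using \<delta> that by auto
      ultimately show ?thesis by linarith
    qed
    ultimately show "\<exists>y\<in>unit_sphere W NW. \<forall>x\<in>F. \<forall>t>0. (1 - \<epsilon>) * (\<bar>f x\<bar> + t) \<le> NW (x + t *\<^sub>R y)"
      by (meson order_trans)
  qed
qed

end
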